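(* Let $\Omega$ be a domain in $\mathbb{R}^N$ with $N\ge3$. Let $H:=\{T\in SO(N):\ T(\Omega)=\Omega\}$. If a natural number $q\neq1,2,4$ and $G_q\subset H$, then $H=SO(N)$.
   Context: A domain is a connected open set. Natural numbers are $1,2,3,\dots$. For $1\le i<j\le N$, $R^{2\pi/q}_{i,j}\in SO(N)$ is the anticlockwise rotation about the origin by the angle $2\pi/q$ in the coordinate plane $(x_i,x_j)$ (all other coordinates fixed). $G_q\subset SO(N)$ is the group generated by the set of rotations $\{R^{2\pi/q}_{i,j}:1\le i<j\le N\}$. *)

theory Defs
  imports "HOL-Analysis.Analysis" "HOL-Algebra.Generated_Groups"
begin

(* R^N is real ^ 'n with N = CARD('n); the linear order on 'n is only used to express
   the condition i < j on pairs of coordinates. *)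

definition SO :: "(real ^ 'n ^ 'n) set" where
  "SO = {T. rotation_matrix T}"

definition SO_group :: "(real ^ 'n ^ 'n) monoid" where
  "SO_group = \<lparr>carrier = SO, mult = (**), one = mat 1\<rparr>"

(* Anticlockwise from the x_i axis towards the x_j axis:
   e_i is mapped to cos t e_i + sin t e_j, and e_j to - sin t e_i + cos t e_j
   (column l is the image of e_l).  Meaningful for i \<noteq> j only. *)
definition plane_rotation :: "'n \<Rightarrow> 'n \<Rightarrow> real \<Rightarrow> real ^ 'n ^ 'n" where
  "plane_rotation i j t = (\<chi> k l.
     if (k = i \<and> l = i) \<or> (k = j \<and> l = j) then cos t
     else if k = i \<and> l = j then - sin t
     else if k = j \<and> l = i then sin t
     else if k = l then 1 else 0)"

definition rotation_subgroup :: "nat \<Rightarrow> (real ^ 'n::{finite, linorder} ^ 'n::{finite, linorder}) set" where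
  "rotation_subgroup q = generate SO_group {plane_rotation i j (2 * pi / real q) | i j. i < j}"

lemma group_SO_group: "group (SO_group :: (real ^ 'n ^ 'n) monoid)"
proof (rule groupI)
  fix T assume "T \<in> carrier (SO_group :: (real ^ 'n ^ 'n) monoid)"
  then have "transpose T \<in> carrier SO_group" "transpose T ** T = mat 1"
    by (auto simp: SO_group_def SO_def rotation_matrix_def orthogonal_matrix_def)
  then show "\<exists>S\<in>carrier SO_group. S \<otimes>\<^bsub>SO_group\<^esub> T = \<one>\<^bsub>SO_group\<^esub>"
    by (auto simp: SO_group_def)
qed (auto simp: SO_group_def SO_def rotation_matrix_def orthogonal_matrix_mul
       orthogonal_matrix_id det_mul matrix_mul_assoc)

lemma plane_rotation_mult:
  assumes "i \<noteq> j"
  shows "plane_rotation i j t *v x = (\<chi> k.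
    if k = i then cos t * x $ i - sin t * x $ j
    else if k = j then sin t * x $ i + cos t * x $ j
    else x $ k)"
proof -
  have "(\<Sum>l\<in>UNIV. plane_rotation i j t $ k $ l * x $ l) =
    (if k = i then cos t * x $ i - sin t * x $ j
     else if k = j then sin t * x $ i + cos t * x $ j else x $ k)" for k
  proof -
    have "(\<Sum>l\<in>UNIV. plane_rotation i j t $ k $ l * x $ l) =
      (\<Sum>l\<in>UNIV. (if l = i then (if k = i then cos t * x $ i else if k = j then sin t * x $ i else 0) else 0)
        + (if l = j then (if k = i then - sin t * x $ j else if k = j then cos t * x $ j else 0) else 0)
        + (if l = k then (if k = i \<or> k = j then 0 else x $ k) else 0))"
      by (rule sum.cong) (use assms in \<open>auto simp: plane_rotation_def\<close>)
    also have "\<dots> = (if k = i then cos t * x $ i - sin t * x $ j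
     else if k = j then sin t * x $ i + cos t * x $ j else x $ k)"
      using assms by (simp add: sum.distrib)
    finally show ?thesis .
  qed
  then show ?thesis
    by (simp only: vec_eq_iff matrix_vector_mult_def vec_lambda_beta simp_thms)
qed

lemma plane_rotation_add:
  assumes "i \<noteq> j"
  shows "plane_rotation i j s ** plane_rotation i j t = plane_rotation i j (s + t)"
proof -
  have "plane_rotation i j s *v (plane_rotation i j t *v x) = plane_rotation i j (s + t) *v x" for x
    using assms unfolding plane_rotation_mult[OF assms]
    by (subst vec_eq_iff, simp only: vec_lambda_beta) (auto simp: cos_add sin_add algebra_simps)
  then show ?thesis
    unfolding matrix_eq matrix_vector_mul_assoc by blast
qed

lemma plane_rotation_in_SO:
  assumes "i \<noteq> j"
  shows "plane_rotation i j t \<in> SO"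
proof -
  have tr: "transpose (plane_rotation i j t) = plane_rotation i j (- t)" for t
  proof -
    have "transpose (plane_rotation i j t) $ k $ l = plane_rotation i j (- t) $ k $ l" for k l
      unfolding plane_rotation_def transpose_def vec_lambda_beta
      using assms by (cases "k = i"; cases "k = j"; cases "l = i"; cases "l = j") simp_all
    then show ?thesis
      unfolding vec_eq_iff by blast
  qed
  have "plane_rotation i j 0 *v x = mat 1 *v x" for x
    unfolding plane_rotation_mult[OF assms] by (subst vec_eq_iff) simp
  then have "plane_rotation i j 0 = mat 1"
    unfolding matrix_eq by blast
  then have orth: "orthogonal_matrix (plane_rotation i j t)" for t
    using assms by (simp add: orthogonal_matrix tr plane_rotation_add)
  have "det (plane_rotation i j t) = det (plane_rotation i j (t / 2) ** plane_rotation i j (t / 2))"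
    using assms by (simp add: plane_rotation_add)
  also have "\<dots> = det (plane_rotation i j (t / 2)) ^ 2"
    by (simp add: det_mul power2_eq_square)
  also have "\<dots> = 1"
    using det_orthogonal_matrix[OF orth[of "t / 2"]] by auto
  finally show ?thesis
    using orth by (simp add: SO_def rotation_matrix_def)
qed

end

theory Submission
  imports Defs
begin

text \<open>
  The stabilizer of an open set is closed in \<open>SO(N)\<close>, so it suffices to find a dense group of rotations
  in it. In three coordinates, rotations by \<open>2\<pi>/q\<close> are represented by the unit quaternions
  \<open>cos (\<pi>/q) + sin (\<pi>/q) e\<close>. For two orthogonal axes the product has real part
  \<open>cos\<^sup>2 (\<pi>/q) = (1 + cos (2\<pi>/q)) / 2\<close>. If this were the cosine of a rational multiple of \<open>\<pi>\<close>, then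
  \<open>cos (2\<pi>/q)\<close> would be an algebraic integer in a cyclotomic ring, so that, for
  \<open>\<zeta> = exp (2\<pi>\<i>/q)\<close>, the root of unity \<open>\<zeta>\<^sup>4\<close> would be congruent to 1 modulo 4; this forces
  \<open>\<zeta>\<^sup>4 = 1\<close>, i.e. \<open>q\<close> divides 4. Otherwise the product generates a dense
  subgroup of the rotations about its axis, and a compactness argument on the set of all axes with that
  property yields every axis. Hence all plane rotations stabilize \<open>\<Omega>\<close>, which is therefore a union of
  spheres centred at the origin.
\<close>

section \<open>Rational angles with \<open>1 + cos (2\<pi>/q) = 2 cos \<psi>\<close>\<close>

text \<open>Modulo 2 the coefficient matrix is the identity, so its determinant is odd, hence
  nonzero. The induction carries this out as Gaussian elimination.\<close>

lemma odd_diagonal_even_system_trivial: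
  fixes b :: "'a \<Rightarrow> 'a \<Rightarrow> int" and v :: "'a \<Rightarrow> complex"
  assumes "finite I"
    and "\<And>i. i \<in> I \<Longrightarrow> odd (b i i)"
    and "\<And>i j. i \<in> I \<Longrightarrow> j \<in> I \<Longrightarrow> i \<noteq> j \<Longrightarrow> even (b i j)"
    and "\<And>i. i \<in> I \<Longrightarrow> (\<Sum>j\<in>I. of_int (b i j) * v j) = 0"
    and "i \<in> I"
  shows "v i = 0"
  using assms
proof (induction I arbitrary: b i rule: finite_induct)
  case empty
  then show ?case by simp
next
  case (insert k I)
  \<comment> \<open>Column \<open>k\<close> is eliminated by cross-multiplication, without division:
    odd times odd minus even times even stays odd on the diagonal, and off it both products are
    even.\<close>
  define d where "d i j = b k k * b i j - b i k * b k j" for i j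
  have row: "(\<Sum>j\<in>I. of_int (b i j) * v j) = - (of_int (b i k) * v k)" if "i \<in> insert k I" for i
    using insert.prems(3)[OF that] insert.hyps by (simp add: eq_neg_iff_add_eq_0 add.commute)
  have zero: "v i = 0" if "i \<in> I" for i
  proof (rule insert.IH[of d])
    show "odd (d i i)" if "i \<in> I" for i
      using that insert.prems(1)[of k] insert.prems(1)[of i] insert.prems(2)[of i k] insert.hyps
      by (auto simp: d_def)
    show "even (d i j)" if "i \<in> I" "j \<in> I" "i \<noteq> j" for i j
      using that insert.prems(2)[of i j] insert.prems(2)[of i k] insert.hyps
      by (auto simp: d_def)
    show "(\<Sum>j\<in>I. of_int (d i j) * v j) = 0" if "i \<in> I" for i
    proof -
      have "(\<Sum>j\<in>I. of_int (d i j) * v j) =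
        of_int (b k k) * (\<Sum>j\<in>I. of_int (b i j) * v j) - of_int (b i k) * (\<Sum>j\<in>I. of_int (b k j) * v j)"
        by (simp add: d_def sum_distrib_left sum_subtractf algebra_simps)
      also have "\<dots> = of_int (b k k) * (- (of_int (b i k) * v k)) - of_int (b i k) * (- (of_int (b k k) * v k))"
        using that by (simp only: row insertI1 insertI2)
      finally show ?thesis by simp
    qed
  qed (use that in simp)
  have "b k k \<noteq> 0"
    using insert.prems(1)[of k] by auto
  then have "v k = 0"
    using row[of k] zero by simp
  then show ?case
    using insert.prems(4) zero by auto
qed

section \<open>The ring of integer combinations of powers of a root of unity\<close>

definition int_combs :: "nat \<Rightarrow> complex \<Rightarrow> complex set" where
  "int_combs n \<xi> = {\<Sum>k<n. of_int (a k) * \<xi> ^ k | a :: nat \<Rightarrow> int. True}"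

locale root_of_unity =
  fixes n :: nat and \<xi> :: complex
  assumes n_pos: "n > 0" and root: "\<xi> ^ n = 1"
begin

lemma int_combs_0: "0 \<in> int_combs n \<xi>"
  unfolding int_combs_def by (intro CollectI exI[of _ "\<lambda>_. 0"]) simp

lemma int_combs_1: "1 \<in> int_combs n \<xi>"
proof -
  have "(\<Sum>k<n. of_int (if k = 0 then 1 else 0) * \<xi> ^ k) = (\<Sum>k<n. if k = 0 then 1 else 0)"
    by (rule sum.cong) auto
  also have "\<dots> = 1"
    using n_pos by (simp add: sum.delta)
  finally show ?thesis
    unfolding int_combs_def by (intro CollectI exI[of _ "\<lambda>k. if k = 0 then 1 else 0"]) simp
qed

lemma int_combs_add:
  assumes "x \<in> int_combs n \<xi>" "y \<in> int_combs n \<xi>"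
  shows "x + y \<in> int_combs n \<xi>"
proof -
  obtain a b where "x = (\<Sum>k<n. of_int (a k) * \<xi> ^ k)" "y = (\<Sum>k<n. of_int (b k) * \<xi> ^ k)"
    using assms unfolding int_combs_def by blast
  then show ?thesis
    unfolding int_combs_def
    by (intro CollectI exI[of _ "\<lambda>k. a k + b k"]) (simp add: sum.distrib algebra_simps)
qed

lemma int_combs_of_int_mult:
  assumes "x \<in> int_combs n \<xi>"
  shows "of_int c * x \<in> int_combs n \<xi>"
proof -
  obtain a where "x = (\<Sum>k<n. of_int (a k) * \<xi> ^ k)"
    using assms unfolding int_combs_def by blast
  then show ?thesis
    unfolding int_combs_def
    by (intro CollectI exI[of _ "\<lambda>k. c * a k"]) (simp add: sum_distrib_left algebra_simps)
qed

lemma int_combs_sum: "(\<And>k. k \<in> K \<Longrightarrow> f k \<in> int_combs n \<xi>) \<Longrightarrow> sum f K \<in> int_combs n \<xi>"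
  by (induction K rule: infinite_finite_induct) (auto intro: int_combs_0 int_combs_add)

text \<open>Multiplication by \<open>\<xi>\<close> shifts the coefficients cyclically, because
  \<open>\<xi> ^ n = 1\<close>; hence the span of the first \<open>n\<close> powers is a ring. The
  powers may be linearly dependent, as coefficients are never compared.\<close>

lemma int_combs_root_mult:
  assumes "x \<in> int_combs n \<xi>"
  shows "\<xi> * x \<in> int_combs n \<xi>"
proof -
  obtain a where x: "x = (\<Sum>k<n. of_int (a k) * \<xi> ^ k)"
    using assms unfolding int_combs_def by blast
  obtain m where m: "n = Suc m"
    using n_pos by (cases n) auto
  define b where "b k = (case k of 0 \<Rightarrow> a m | Suc l \<Rightarrow> a l)" for k
  have "\<xi> * x = (\<Sum>k<m. of_int (a k) * \<xi> ^ Suc k) + of_int (a m) * \<xi> ^ n"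
    by (simp add: x m sum_distrib_left algebra_simps)
  also have "\<dots> = (\<Sum>k<n. of_int (b k) * \<xi> ^ k)"
    unfolding root unfolding m sum.lessThan_Suc_shift by (simp add: b_def)
  finally show ?thesis
    unfolding int_combs_def by blast
qed

lemma int_combs_root_power_mult:
  "x \<in> int_combs n \<xi> \<Longrightarrow> \<xi> ^ k * x \<in> int_combs n \<xi>"
  by (induction k) (auto simp: mult.assoc intro: int_combs_root_mult)

lemma int_combs_root_power: "\<xi> ^ k \<in> int_combs n \<xi>"
  using int_combs_root_power_mult[OF int_combs_1, of k] by simp

lemma int_combs_mult:
  assumes "x \<in> int_combs n \<xi>" "y \<in> int_combs n \<xi>"
  shows "x * y \<in> int_combs n \<xi>"
proof -
  obtain a where "x = (\<Sum>k<n. of_int (a k) * \<xi> ^ k)"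
    using assms unfolding int_combs_def by blast
  then have "x * y = (\<Sum>k<n. of_int (a k) * (\<xi> ^ k * y))"
    by (simp add: sum_distrib_right mult.assoc)
  then show ?thesis
    using assms by (auto intro!: int_combs_sum int_combs_of_int_mult int_combs_root_power_mult)
qed

lemma int_combs_of_int: "of_int c \<in> int_combs n \<xi>"
  using int_combs_of_int_mult[OF int_combs_1, of c] by simp

lemma int_combs_diff:
  "x \<in> int_combs n \<xi> \<Longrightarrow> y \<in> int_combs n \<xi> \<Longrightarrow> x - y \<in> int_combs n \<xi>"
  using int_combs_add[of x "of_int (-1) * y"] int_combs_of_int_mult[of y "-1"] by simp

text \<open>If \<open>1/2\<close> lay in the ring, then the vector of powers of \<open>\<xi>\<close> would be killed by \<open>1 - 2 A\<close>
  for an integer matrix \<open>A\<close>, and such a matrix has odd determinant.\<close>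

lemma half_not_in_int_combs: "1 / 2 \<notin> int_combs n \<xi>"
proof
  assume half: "1 / 2 \<in> int_combs n \<xi>"
  have "\<exists>a :: nat \<Rightarrow> int. \<xi> ^ i * (1 / 2) = (\<Sum>k<n. of_int (a k) * \<xi> ^ k)" for i
    using int_combs_root_power_mult[OF half, of i] unfolding int_combs_def by blast
  then obtain A :: "nat \<Rightarrow> nat \<Rightarrow> int"
    where A: "\<And>i. \<xi> ^ i * (1 / 2) = (\<Sum>k<n. of_int (A i k) * \<xi> ^ k)"
    by metis
  define b where "b i j = (if i = j then 1 else 0) - 2 * A i j" for i j
  have "\<xi> ^ 0 = 0"
  proof (rule odd_diagonal_even_system_trivial[where I = "{..<n}" and b = b and v = "\<lambda>j. \<xi> ^ j" and i = 0])
    show "(\<Sum>j<n. of_int (b i j) * \<xi> ^ j) = 0" if "i \<in> {..<n}" for i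
    proof -
      have "(\<Sum>j<n. of_int (b i j) * \<xi> ^ j) =
        (\<Sum>j<n. (if i = j then \<xi> ^ j else 0) - 2 * (of_int (A i j) * \<xi> ^ j))"
        by (rule sum.cong) (auto simp: b_def algebra_simps)
      also have "\<dots> = (\<Sum>j<n. if i = j then \<xi> ^ j else 0) - 2 * (\<Sum>j<n. of_int (A i j) * \<xi> ^ j)"
        by (simp add: sum_subtractf sum_distrib_left)
      also have "\<dots> = \<xi> ^ i - 2 * (\<xi> ^ i * (1 / 2))"
        using that by (simp only: A[symmetric]) simp
      finally show ?thesis by simp
    qed
  qed (use n_pos in \<open>auto simp: b_def\<close>)
  then show False by simp
qed

lemma odd_half_not_in_int_combs:
  assumes "odd m"
  shows "of_int m / 2 \<notin> int_combs n \<xi>"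
proof
  assume "of_int m / 2 \<in> int_combs n \<xi>"
  moreover obtain k where "m = 2 * k + 1"
    using assms by (elim oddE)
  ultimately have "of_int m / 2 - of_int k \<in> int_combs n \<xi>" "of_int m / 2 - of_int k = (1 / 2 :: complex)"
    by (auto simp del: of_int_mult intro!: int_combs_diff int_combs_of_int) (simp add: add_divide_distrib)
  then show False
    using half_not_in_int_combs by simp
qed

lemma quarter_in_int_combs_imp_dvd:
  assumes "of_int m / 4 \<in> int_combs n \<xi>"
  shows "4 dvd m"
proof (rule ccontr)
  assume *: "\<not> 4 dvd m"
  have half: "of_int m / 2 \<in> int_combs n \<xi>"
    using int_combs_of_int_mult[OF assms, of 2] by simp
  then obtain k where k: "m = 2 * k"
    using odd_half_not_in_int_combs by blast
  then have "odd k"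
    using * by auto
  then show False
    using odd_half_not_in_int_combs[of k] assms k by simp
qed

text \<open>If \<open>1 + 4 * u\<close> had order \<open>l > 1\<close>, its first \<open>l\<close>
  powers, all 1 modulo 4, would sum to 0, so 4 would divide \<open>l\<close>. Its power with
  exponent \<open>l / 2\<close> would then be -1, and -1 = 1 + 4 v would put -1/2 into the
  ring.\<close>

lemma root_of_unity_cong_1_mod_4:
  assumes u: "u \<in> int_combs n \<xi>" and m: "m > 0" "(1 + 4 * u) ^ m = 1"
  shows "u = 0"
proof (rule ccontr)
  assume "u \<noteq> 0"
  define \<eta> where "\<eta> = 1 + 4 * u"
  define l where "l = (LEAST l. l > 0 \<and> \<eta> ^ l = 1)"
  have l: "l > 0" "\<eta> ^ l = 1"
    using LeastI[of "\<lambda>l. l > 0 \<and> \<eta> ^ l = 1" m] m by (auto simp: l_def \<eta>_def)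
  have l_le: "l \<le> k" if "k > 0" "\<eta> ^ k = 1" for k
    unfolding l_def by (rule Least_le) (use that in simp)
  have pow: "\<exists>v\<in>int_combs n \<xi>. \<eta> ^ k = 1 + 4 * v" for k
  proof (induction k)
    case 0
    then show ?case using int_combs_0 by force
  next
    case (Suc k)
    then obtain v where v: "v \<in> int_combs n \<xi>" "\<eta> ^ k = 1 + 4 * v" by blast
    have "\<eta> ^ Suc k = (1 + 4 * u) * (1 + 4 * v)"
      by (simp add: v flip: \<eta>_def)
    also have "\<dots> = 1 + 4 * (u + v + of_int 4 * (u * v))"
      by (simp add: algebra_simps)
    finally have "\<eta> ^ Suc k = 1 + 4 * (u + v + of_int 4 * (u * v))" .
    then show ?case
      using u v by (blast intro: int_combs_add int_combs_of_int_mult int_combs_mult)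
  qed
  then obtain v where v: "\<And>k. v k \<in> int_combs n \<xi>" "\<And>k. \<eta> ^ k = 1 + 4 * v k"
    by metis
  have "\<eta> \<noteq> 1"
    using \<open>u \<noteq> 0\<close> by (simp add: \<eta>_def)
  then have "0 = (\<Sum>k<l. \<eta> ^ k)"
    using l by (simp add: sum_gp_strict)
  also have "\<dots> = of_nat l + 4 * (\<Sum>k<l. v k)"
    by (simp add: v sum.distrib sum_distrib_left)
  finally have "of_int (- int l) / 4 = (\<Sum>k<l. v k)"
    by (simp add: field_simps add_eq_0_iff)
  then have "4 dvd - int l"
    by (intro quarter_in_int_combs_imp_dvd) (auto intro: int_combs_sum v)
  then have "even l"
    by presburger
  then obtain k where k: "l = 2 * k"
    by blast
  then have "\<eta> ^ k \<noteq> 1"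
    using l_le[of k] l by auto
  moreover have "(\<eta> ^ k)\<^sup>2 = 1"
    using l k by (simp add: power_mult[symmetric] mult.commute)
  ultimately have "\<eta> ^ k = -1"
    by (simp add: power2_eq_1_iff)
  then have "2 * (2 * v k) = 2 * (- 1)"
    using v(2)[of k] by (simp add: eq_neg_iff_add_eq_0 add.commute)
  then have "of_int (-1) / 2 = v k"
    by (simp only: mult_cancel_left) (simp add: field_simps)
  then show False
    using odd_half_not_in_int_combs[of "-1"] v(1)[of k] by simp
qed

end

text \<open>The identity puts the cosine itself, not just its double, into a ring generated by a
  root of unity. The conclusion is sharp: \<open>q\<close> = 1, 2, 4 satisfy the identity with
  \<open>r\<close> = 0, 1/2, 1/3.\<close>

lemma cos_rational_identity_imp_dvd_4:
  fixes q :: nat and r :: real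
  assumes q: "q > 0" and r: "r \<in> \<rat>" and eq: "1 + cos (2 * pi / q) = 2 * cos (pi * r)"
  shows "q dvd 4"
proof -
  obtain a b :: nat where ab: "b \<noteq> 0" "\<bar>r\<bar> = a / b"
    using Rats_abs_nat_div_natE[OF r] by metis
  \<comment> \<open>The angle is fine enough that both \<open>w\<close> and \<open>\<zeta>\<close>
    below are natural powers of \<open>\<xi>\<close>.\<close>
  define \<xi> where "\<xi> = cis (pi / (real b * real q))"
  define n where "n = 2 * b * q"
  have "real n * (pi / (real b * real q)) = 2 * pi"
    using ab q by (simp add: n_def field_simps)
  then have "\<xi> ^ n = 1"
    unfolding \<xi>_def Complex.DeMoivre by (simp only: cis_2pi)
  then interpret root_of_unity n \<xi>
    by unfold_locales (use ab q in \<open>simp_all add: n_def\<close>)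
  define w where "w = cis (pi * \<bar>r\<bar>)"
  define \<zeta> where "\<zeta> = cis (2 * pi / q)"
  have w: "w = \<xi> ^ (a * q)" and \<zeta>: "\<zeta> = \<xi> ^ (2 * b)"
    using q ab(1) by (simp_all add: w_def \<xi>_def \<zeta>_def Complex.DeMoivre ab(2) mult.commute)
  \<comment> \<open>The conjugate of \<open>w\<close> is its inverse, and \<open>w ^ n = 1\<close>
    turns that inverse into a natural power.\<close>
  have "w * w ^ (n - 1) = w ^ n"
    using power_minus_mult[OF n_pos, of w] by (simp only: mult.commute)
  also have "\<dots> = (\<xi> ^ n) ^ (a * q)"
    unfolding w by (simp only: power_mult[symmetric] mult.commute)
  finally have "w * w ^ (n - 1) = w * cnj w"
    unfolding root by (simp add: w_def cis_cnj cis_mult)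
  then have "cnj w = w ^ (n - 1)"
    by (simp add: w_def)
  then have "cnj w = \<xi> ^ (a * q * (n - 1))"
    by (simp only: w power_mult[of \<xi> "a * q"])
  then have cnj_wR: "cnj w \<in> int_combs n \<xi>"
    by (simp only: int_combs_root_power)
  have wR: "w \<in> int_combs n \<xi>" and \<zeta>R: "\<zeta> \<in> int_combs n \<xi>"
    unfolding w \<zeta> by (rule int_combs_root_power)+
  define c where "c = complex_of_real (cos (2 * pi / q))"
  have "cos (2 * pi / q) = 2 * cos (pi * \<bar>r\<bar>) - 1"
    using eq by (cases "r \<ge> 0") auto
  then have "c = complex_of_real (2 * cos (pi * \<bar>r\<bar>)) - of_int 1"
    by (simp add: c_def)
  also have "complex_of_real (2 * cos (pi * \<bar>r\<bar>)) = w + cnj w"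
    by (simp add: w_def complex_eq_iff)
  finally have cR: "c \<in> int_combs n \<xi>"
    using wR cnj_wR by (auto intro!: int_combs_add int_combs_diff int_combs_of_int simp del: of_int_1)
  \<comment> \<open>This is the quadratic equation of \<open>\<zeta>\<close>, with trace
    \<open>2 * c\<close>. Squaring \<open>2 * x - 1\<close> for \<open>x = \<zeta> * c\<close>
    produces a multiple of 4 besides the 1.\<close>
  have "\<zeta> * (\<zeta> + cnj \<zeta>) = \<zeta>\<^sup>2 + 1"
    by (simp add: \<zeta>_def cis_cnj cis_mult distrib_left power2_eq_square)
  moreover have "\<zeta> + cnj \<zeta> = 2 * c"
    by (simp add: \<zeta>_def c_def complex_eq_iff)
  ultimately have "\<zeta>\<^sup>2 = 2 * \<zeta> * c - 1"
    by (simp add: algebra_simps)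
  then have "(\<zeta>\<^sup>2)\<^sup>2 = (2 * \<zeta> * c - 1)\<^sup>2"
    by simp
  also have "\<dots> = 1 + 4 * (\<zeta> * c * (\<zeta> * c) - \<zeta> * c)"
    by (simp add: power2_eq_square algebra_simps)
  finally have \<zeta>4: "\<zeta> ^ 4 = 1 + 4 * (\<zeta> * c * (\<zeta> * c) - \<zeta> * c)"
    by (simp flip: power_mult)
  have "\<zeta> ^ q = 1"
    using q by (simp add: \<zeta>_def Complex.DeMoivre)
  then have "(\<zeta> ^ 4) ^ q = 1"
    by (metis power_commutes power_mult mult.commute power_one)
  then have "\<zeta> * c * (\<zeta> * c) - \<zeta> * c = 0"
    unfolding \<zeta>4 using q cR \<zeta>R
    by (intro root_of_unity_cong_1_mod_4[of _ q]) (auto intro!: int_combs_diff int_combs_mult)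
  then have "cis (4 * (2 * pi / q)) = 1"
    using \<zeta>4 by (simp add: \<zeta>_def Complex.DeMoivre)
  then have "cos (4 * (2 * pi / q)) = 1"
    by (simp add: complex_eq_iff)
  then obtain k :: int where "4 * (2 * pi / q) = k * 2 * pi"
    by (auto simp: cos_one_2pi_int)
  then have "4 = k * real q"
    using q by (simp add: field_simps)
  then have "4 = k * int q"
    by (metis of_int_eq_iff of_int_mult of_int_numeral of_int_of_nat_eq)
  then have "int q dvd int 4"
    by (metis dvd_triv_right of_nat_numeral)
  then show ?thesis
    by (simp only: int_dvd_int_iff)
qed

section \<open>Closed groups of unit quaternions\<close>

lemma vec3_eqI: "x = y" if "x $ 1 = y $ 1" "x $ 2 = y $ 2" "x $ 3 = y $ 3" for x y :: "'a ^ 3"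
  using that by (simp add: vec_eq_iff forall_3)

lemma inner_vec3: "x \<bullet> y = x $ 1 * y $ 1 + x $ 2 * y $ 2 + x $ 3 * y $ 3" for x y :: "real ^ 3"
  by (simp add: inner_vec_def sum_3)

type_synonym quat = "real \<times> (real ^ 3)"

definition quat_mult :: "quat \<Rightarrow> quat \<Rightarrow> quat" where
  "quat_mult p s = (fst p * fst s - snd p \<bullet> snd s,
     fst p *\<^sub>R snd s + fst s *\<^sub>R snd p + cross3 (snd p) (snd s))"

definition quat_conj :: "quat \<Rightarrow> quat" where
  "quat_conj p = (fst p, - snd p)"

text \<open>For a unit quaternion \<open>p\<close> this is the rotation \<open>w \<mapsto> p w p\<^sup>*\<close> of the imaginary quaternions.\<close>

definition quat_rot :: "quat \<Rightarrow> real ^ 3 \<Rightarrow> real ^ 3" where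
  "quat_rot p w = ((fst p)\<^sup>2 - snd p \<bullet> snd p) *\<^sub>R w + (2 * (snd p \<bullet> w)) *\<^sub>R snd p
     + (2 * fst p) *\<^sub>R cross3 (snd p) w"

text \<open>For a unit vector \<open>a\<close> this is the exponential of \<open>t\<close> times
  \<open>a\<close>. Under \<open>quat_rot\<close> it acts as the rotation about \<open>a\<close> by
  \<open>2 * t\<close>, whence the half angles later.\<close>

abbreviation quat_cis :: "real ^ 3 \<Rightarrow> real \<Rightarrow> quat" where
  "quat_cis a t \<equiv> (cos t, sin t *\<^sub>R a)"

lemma norm_quat: "(norm p)\<^sup>2 = (fst p)\<^sup>2 + snd p \<bullet> snd p" for p :: quat
  by (cases p) (simp add: norm_Pair power2_norm_eq_inner)

lemma quat_mult_assoc: "quat_mult (quat_mult p s) t = quat_mult p (quat_mult s t)"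
proof (rule prod_eqI)
  show "fst (quat_mult (quat_mult p s) t) = fst (quat_mult p (quat_mult s t))"
    unfolding quat_mult_def by (simp add: inner_vec3 cross_components) algebra
  show "snd (quat_mult (quat_mult p s) t) = snd (quat_mult p (quat_mult s t))"
    by (rule vec3_eqI; simp add: quat_mult_def inner_vec3 cross_components; algebra)
qed

lemma quat_conj_mult: "quat_conj (quat_mult p s) = quat_mult (quat_conj s) (quat_conj p)"
  by (simp add: quat_conj_def quat_mult_def cross_skew[of "snd p"] inner_commute)

lemma quat_conj_conj: "quat_conj (quat_conj p) = p"
  by (simp add: quat_conj_def)

lemma norm_quat_conj: "norm (quat_conj p) = norm p"
  by (simp add: quat_conj_def norm_prod_def)

text \<open>The scalar part \<open>r\<close> is arbitrary so that the identity covers both imaginary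
  quaternions, for composing rotations, and the elements \<open>quat_cis a t\<close>, for rotating
  axes.\<close>

lemma quat_conjugation: "quat_mult (quat_mult p (r, v)) (quat_conj p) = ((norm p)\<^sup>2 * r, quat_rot p v)"
proof (rule prod_eqI)
  show "fst (quat_mult (quat_mult p (r, v)) (quat_conj p)) = fst ((norm p)\<^sup>2 * r, quat_rot p v)"
    by (simp add: norm_quat quat_mult_def quat_conj_def inner_vec3 cross_components) algebra
  show "snd (quat_mult (quat_mult p (r, v)) (quat_conj p)) = snd ((norm p)\<^sup>2 * r, quat_rot p v)"
    by (rule vec3_eqI; simp add: quat_mult_def quat_rot_def quat_conj_def inner_vec3 cross_components; algebra)
qed

lemma quat_rot_mult: "quat_rot (quat_mult p s) w = quat_rot p (quat_rot s w)"
proof -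
  have "((norm (quat_mult p s))\<^sup>2 * 0, quat_rot (quat_mult p s) w)
    = quat_mult (quat_mult p (quat_mult (quat_mult s (0, w)) (quat_conj s))) (quat_conj p)"
    unfolding quat_conjugation[symmetric] by (simp only: quat_conj_mult quat_mult_assoc)
  then show ?thesis
    by (simp add: quat_conjugation)
qed

lemma norm_quat_mult: "norm (quat_mult p s) = norm p * norm s"
proof -
  have "(norm (quat_mult p s))\<^sup>2 = (norm p * norm s)\<^sup>2"
    unfolding power_mult_distrib norm_quat
    by (simp add: quat_mult_def inner_vec3 cross_components) algebra
  then show ?thesis by simp
qed

lemma quat_mult_conj_right: "norm p = 1 \<Longrightarrow> quat_mult p (quat_conj p) = (1, 0)"
  using norm_quat[of p] by (simp add: quat_mult_def quat_conj_def power2_eq_square)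

lemma quat_mult_conj_left: "norm p = 1 \<Longrightarrow> quat_mult (quat_conj p) p = (1, 0)"
  using norm_quat[of p] by (simp add: quat_mult_def quat_conj_def power2_eq_square)

lemma quat_rot_1: "quat_rot (1, 0) w = w"
  by (simp add: quat_rot_def)

lemma norm_quat_rot:
  assumes "norm p = 1"
  shows "norm (quat_rot p v) = norm v"
proof -
  have "norm (0 :: real, quat_rot p v) = norm (quat_mult (quat_mult p (0, v)) (quat_conj p))"
    by (simp add: quat_conjugation)
  then show ?thesis
    using assms by (simp add: norm_quat_mult norm_quat_conj norm_Pair)
qed

lemma norm_quat_cis: "norm a = 1 \<Longrightarrow> norm (quat_cis a t) = 1"
  by (simp add: norm_Pair power_mult_distrib)

lemma quat_mult_cis:
  assumes "norm a = 1"
  shows "quat_mult (quat_cis a s) (quat_cis a t) = quat_cis a (s + t)"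
proof -
  have "a \<bullet> a = 1"
    using assms by (simp add: norm_eq_1)
  then show ?thesis
    by (simp add: quat_mult_def cos_add sin_add cross_mult_left cross_mult_right scaleR_add_left
        mult.commute)
qed

lemma quat_conj_cis: "quat_conj (quat_cis a t) = quat_cis a (- t)"
  by (simp add: quat_conj_def)

lemma continuous_on_quat_cis: "continuous_on S (quat_cis a)"
  by (intro continuous_intros)

text \<open>The sinusoid attains the square root of \<open>A\<^sup>2 + B\<^sup>2\<close>, which
  exceeds \<open>A\<close> unless \<open>B = 0\<close>. This is the critical point test at 0 without
  derivatives.\<close>

lemma sinusoid_max_at_0:
  fixes A B :: real
  assumes "\<And>t. A * cos t + B * sin t \<le> A"
  shows "B = 0"
proof (rule ccontr)
  assume "B \<noteq> 0"
  define R where "R = sqrt (A\<^sup>2 + B\<^sup>2)"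
  have R: "R > 0" "R\<^sup>2 = A\<^sup>2 + B\<^sup>2"
    using \<open>B \<noteq> 0\<close> by (auto simp: R_def add_nonneg_pos)
  have "A\<^sup>2 + B\<^sup>2 \<noteq> 0"
    using \<open>B \<noteq> 0\<close> by simp
  with R have "(A / R)\<^sup>2 + (B / R)\<^sup>2 = 1"
    by (simp add: power_divide add_divide_distrib[symmetric] del: sum_power2_eq_zero_iff)
  then obtain t where "A / R = cos t" "B / R = sin t"
    using sincos_total_2pi by metis
  then have "A * (A / R) + B * (B / R) \<le> A"
    using assms[of t] by simp
  moreover have "A * (A / R) + B * (B / R) = R\<^sup>2 / R"
    unfolding R(2) by (simp add: power2_eq_square add_divide_distrib)
  ultimately have "R \<le> A"
    using R(1) by (simp add: power2_eq_square)
  then have "A\<^sup>2 + B\<^sup>2 \<le> A\<^sup>2"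
    unfolding R(2)[symmetric] using R(1) by (intro power_mono) auto
  then show False
    using \<open>B \<noteq> 0\<close> by simp
qed

section \<open>Circle subgroups of a closed quaternion group\<close>

locale closed_quat_group =
  fixes \<Gamma> :: "quat set"
  assumes closed: "closed \<Gamma>"
    and norm_1: "p \<in> \<Gamma> \<Longrightarrow> norm p = 1"
    and mult: "p \<in> \<Gamma> \<Longrightarrow> s \<in> \<Gamma> \<Longrightarrow> quat_mult p s \<in> \<Gamma>"
    and conj: "p \<in> \<Gamma> \<Longrightarrow> quat_conj p \<in> \<Gamma>"
begin

text \<open>The directions of the circle subgroups inside \<open>\<Gamma>\<close>: the unit sphere
  of its Lie algebra.\<close>

definition full_axes :: "(real ^ 3) set" where
  "full_axes = {a. norm a = 1 \<and> (\<forall>t. quat_cis a t \<in> \<Gamma>)}"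

text \<open>The positive multiples of \<open>\<psi>\<close> are dense modulo full turns by
  Kronecker's theorem, and the angles \<open>t\<close> with \<open>quat_cis a t\<close> in
  \<open>\<Gamma>\<close> form a closed set.\<close>

lemma irrational_imp_full_axis:
  assumes a: "norm a = 1" and \<psi>: "quat_cis a \<psi> \<in> \<Gamma>" and irr: "\<psi> / pi \<notin> \<rat>"
  shows "a \<in> full_axes"
proof -
  have one: "quat_cis a 0 \<in> \<Gamma>"
    using mult[OF conj[OF \<psi>] \<psi>] norm_1[OF \<psi>] by (simp add: quat_mult_conj_left)
  have nat_mult: "quat_cis a (of_nat k * \<psi>) \<in> \<Gamma>" for k
  proof (induction k)
    case 0
    then show ?case using one by simp
  next
    case (Suc k)
    show ?case
      using mult[OF \<psi> Suc] unfolding quat_mult_cis[OF a] by (simp add: algebra_simps)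
  qed
  have irr2: "\<psi> / (2 * pi) \<notin> \<rat>"
  proof
    assume "\<psi> / (2 * pi) \<in> \<rat>"
    then have "2 * (\<psi> / (2 * pi)) \<in> \<rat>"
      by (intro Rats_mult) auto
    then show False
      using irr by simp
  qed
  have "quat_cis a t \<in> \<Gamma>" for t
  proof -
    have "closed (quat_cis a -` \<Gamma>)"
      using closed continuous_on_quat_cis by (intro closed_vimage) auto
    moreover have "t \<in> closure (quat_cis a -` \<Gamma>)"
      unfolding closure_approachable
    proof (intro allI impI)
      fix e :: real
      assume "e > 0"
      then have "e / (2 * pi) > 0"
        by simp
      from sequence_of_fractional_parts_is_dense[OF irr2 this, of "t / (2 * pi)"]
      obtain h k where k: "k > 0" "\<bar>of_int k * (\<psi> / (2 * pi)) - of_int h - t / (2 * pi)\<bar> < e / (2 * pi)"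
        by blast
      have "of_int k * (\<psi> / (2 * pi)) - of_int h - t / (2 * pi)
        = (of_int k * \<psi> - 2 * pi * of_int h - t) / (2 * pi)"
        by (simp add: field_simps)
      then have near: "\<bar>of_int k * \<psi> - 2 * pi * of_int h - t\<bar> < e"
        using k(2) by (simp only: abs_divide) (simp add: divide_less_cancel)
      have "quat_cis a (of_int k * \<psi> - 2 * pi * of_int h) = quat_cis a (of_nat (nat k) * \<psi>)"
        using k(1) by (simp add: cos_diff sin_diff cos_int_2pin sin_int_2pin)
      then show "\<exists>y\<in>quat_cis a -` \<Gamma>. dist y t < e"
        using near nat_mult[of "nat k"]
        by (intro bexI[of _ "of_int k * \<psi> - 2 * pi * of_int h"]) (auto simp: dist_real_def)
    qed
    ultimately show ?thesis
      by (simp add: closure_closed)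
  qed
  then show ?thesis
    using a by (simp add: full_axes_def)
qed

text \<open>In polar form the axis is the normalised \<open>v\<close>. The factor \<open>l\<close>
  is left unspecified because later only orthogonality to \<open>v\<close> is tested.\<close>

lemma unit_quat_full_axis:
  assumes "(r, v) \<in> \<Gamma>" and irr: "\<And>x. x \<in> \<rat> \<Longrightarrow> r \<noteq> cos (pi * x)"
  obtains l where "l \<noteq> 0" "l *\<^sub>R v \<in> full_axes"
proof -
  have n: "r\<^sup>2 + (norm v)\<^sup>2 = 1"
    using norm_1[OF assms(1)] norm_quat[of "(r, v)"] by (simp add: power2_norm_eq_inner)
  have "v \<noteq> 0"
  proof
    assume "v = 0"
    then have "r = 1 \<or> r = -1"
      using n by (simp add: power2_eq_1_iff)
    then show False
      using irr[of 0] irr[of 1] by auto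
  qed
  obtain \<psi> where \<psi>: "r = cos \<psi>" "norm v = sin \<psi>"
    using n sincos_total_2pi by metis
  define a where "a = (1 / norm v) *\<^sub>R v"
  have "quat_cis a \<psi> = (r, v)"
    using \<open>v \<noteq> 0\<close> by (simp add: a_def \<psi>(1) flip: \<psi>(2))
  moreover have "norm a = 1"
    using \<open>v \<noteq> 0\<close> by (simp add: a_def)
  moreover have "\<psi> / pi \<notin> \<rat>"
    using irr[of "\<psi> / pi"] \<psi> by auto
  ultimately have "a \<in> full_axes"
    using assms(1) by (intro irrational_imp_full_axis[of _ \<psi>]) auto
  then show thesis
    using that[of "1 / norm v"] \<open>v \<noteq> 0\<close> by (simp add: a_def)
qed

lemma compact_full_axes: "compact full_axes"
proof -
  have "full_axes = sphere 0 1 \<inter> (\<Inter>t. (\<lambda>a. quat_cis a t) -` \<Gamma>)"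
    by (auto simp: full_axes_def)
  moreover have "closed ((\<lambda>a. quat_cis a t) -` \<Gamma>)" for t
    using closed by (intro closed_vimage continuous_intros) auto
  ultimately show ?thesis
    by (simp only:) (intro compact_Int_closed compact_sphere closed_INT ballI)
qed

text \<open>Conjugation by \<open>p\<close> carries the circle subgroup about \<open>a\<close> to
  the one about the rotated axis.\<close>

lemma full_axes_rot:
  assumes "p \<in> \<Gamma>" "a \<in> full_axes"
  shows "quat_rot p a \<in> full_axes"
proof -
  have p: "norm p = 1"
    by (rule norm_1[OF assms(1)])
  have "quat_cis (quat_rot p a) t \<in> \<Gamma>" for t
  proof -
    have "quat_mult (quat_mult p (quat_cis a t)) (quat_conj p) \<in> \<Gamma>"
      using assms by (auto simp: full_axes_def intro: mult conj)
    moreover have "quat_rot p (sin t *\<^sub>R a) = sin t *\<^sub>R quat_rot p a"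
      by (simp add: quat_rot_def cross_mult_right scaleR_add_right ac_simps)
    ultimately show ?thesis
      by (simp add: quat_conjugation p)
  qed
  then show ?thesis
    using assms by (simp add: full_axes_def norm_quat_rot[OF p])
qed

text \<open>A point \<open>y\<close> of the compact set of full axes maximising \<open>y \<bullet> u\<close> is a critical point along the
  circles obtained by rotating \<open>y\<close> about the other full axes \<open>z\<close>, i.e. \<open>y \<times> u\<close> is orthogonal to every \<open>z\<close>.\<close>

lemma full_axes_spanning:
  assumes ne: "full_axes \<noteq> {}"
    and spanning: "\<And>w. (\<And>z. z \<in> full_axes \<Longrightarrow> z \<bullet> w = 0) \<Longrightarrow> w = 0"
    and u: "norm u = 1"
  shows "quat_cis u t \<in> \<Gamma>"
proof -
  have "continuous_on full_axes (\<lambda>a. a \<bullet> u)"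
    by (intro continuous_intros)
  then obtain y where y: "y \<in> full_axes" "\<And>a. a \<in> full_axes \<Longrightarrow> a \<bullet> u \<le> y \<bullet> u"
    using continuous_attains_sup[OF compact_full_axes ne] by metis
  have "cross3 y u = 0"
  proof (rule spanning)
    fix z
    assume z: "z \<in> full_axes"
    then have zz: "z \<bullet> z = 1"
      by (simp add: full_axes_def norm_eq_1)
    have "cross3 z y \<bullet> u = 0"
    proof (rule sinusoid_max_at_0)
      fix s :: real
      \<comment> \<open>Half of \<open>s\<close>, since \<open>quat_cis z t\<close> rotates
        \<open>y\<close> about \<open>z\<close> by \<open>2 * t\<close>.\<close>
      define t where "t = s / 2"
      have s: "cos s = (cos t)\<^sup>2 - (sin t)\<^sup>2" "sin s = 2 * sin t * cos t"
        using cos_double[of t] sin_double[of t] by (simp_all add: t_def)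
      have "quat_rot (quat_cis z t) y \<bullet> u \<le> y \<bullet> u"
        using y z by (intro y(2) full_axes_rot) (auto simp: full_axes_def)
      moreover have "quat_rot (quat_cis z t) y \<bullet> u = cos s * (y \<bullet> u)
          + 2 * (sin t)\<^sup>2 * (z \<bullet> y) * (z \<bullet> u) + sin s * (cross3 z y \<bullet> u)"
        by (simp add: quat_rot_def s zz cross_mult_left inner_add_left power2_eq_square)
      moreover have "2 * (sin t)\<^sup>2 = 1 - cos s"
        using sin_cos_squared_add[of t] s by linarith
      ultimately show "(y \<bullet> u - (z \<bullet> y) * (z \<bullet> u)) * cos s + (cross3 z y \<bullet> u) * sin s
          \<le> y \<bullet> u - (z \<bullet> y) * (z \<bullet> u)"
        by (simp add: algebra_simps)
    qed
    then show "z \<bullet> cross3 y u = 0"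
      by (simp add: cross3_simps)
  qed
  then have "collinear {0, y, u}"
    by (simp add: cross_eq_0)
  moreover have "norm y = 1"
    using y by (simp add: full_axes_def)
  \<comment> \<open>Parallel unit vectors agree up to sign, and the opposite axis has the same
    circle subgroup, traversed backwards.\<close>
  ultimately have "u = y \<or> u = - y"
    using u by (auto simp: collinear_lemma) (metis abs_1 abs_eq_iff mult.right_neutral scaleR_minus1_left scaleR_one)
  then show ?thesis
  proof
    assume "u = y"
    then show ?thesis using y by (simp add: full_axes_def)
  next
    assume "u = - y"
    then have "quat_cis u t = quat_cis y (- t)" by simp
    then show ?thesis using y by (simp only: full_axes_def) blast
  qed
qed

text \<open>For each choice of signs of the two angles, the product of the rotations has scalar part
  \<open>c\<^sup>2\<close>, which is no cosine of a rational multiple of pi. The full axes so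
  obtained span the space.\<close>

lemma two_generators_full:
  assumes q: "q > 0" "\<not> q dvd 4"
    and gen: "quat_cis (axis 1 1) (pi / real q) \<in> \<Gamma>" "quat_cis (axis 2 1) (pi / real q) \<in> \<Gamma>"
    and u: "norm u = 1"
  shows "quat_cis u t \<in> \<Gamma>"
proof -
  define \<beta> where "\<beta> = pi / real q"
  define c s where "c = cos \<beta>" and "s = sin \<beta>"
  have c2: "2 * c\<^sup>2 = 1 + cos (2 * pi / real q)"
    using cos_double_cos[of \<beta>] by (simp add: c_def \<beta>_def)
  have irr: "c\<^sup>2 \<noteq> cos (pi * x)" if "x \<in> \<rat>" for x
    using cos_rational_identity_imp_dvd_4[OF q(1) that] q(2) c2 by auto
  have "c \<noteq> 0"
    using irr[of "1 / 2"] by auto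
  have "s \<noteq> 0"
  proof
    assume "s = 0"
    then have "c\<^sup>2 = cos (pi * 0)"
      using sin_cos_squared_add[of \<beta>] by (simp add: c_def s_def)
    then show False
      using irr[of 0] by simp
  qed
  have gen': "quat_cis (axis i 1) (\<epsilon> * \<beta>) \<in> \<Gamma>" if "i \<in> {1, 2}" "\<epsilon> \<in> {1, -1}" for i :: 3 and \<epsilon> :: real
    using gen conj[OF gen(1)] conj[OF gen(2)] that by (auto simp: \<beta>_def quat_conj_def)
  have axes: "\<exists>l. l \<noteq> 0 \<and> l *\<^sub>R vector [\<epsilon> * (c * s), \<delta> * (c * s), \<epsilon> * \<delta> * s\<^sup>2] \<in> full_axes"
    if sgn: "\<epsilon> \<in> {1, -1}" "\<delta> \<in> {1, -1}" for \<epsilon> \<delta>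
  proof -
    have "cos (\<epsilon> * \<beta>) = c" "cos (\<delta> * \<beta>) = c" "sin (\<epsilon> * \<beta>) = \<epsilon> * s" "sin (\<delta> * \<beta>) = \<delta> * s"
      using sgn by (auto simp: c_def s_def)
    then have "quat_mult (quat_cis (axis 1 1) (\<epsilon> * \<beta>)) (quat_cis (axis 2 1) (\<delta> * \<beta>))
      = (c\<^sup>2, vector [\<epsilon> * (c * s), \<delta> * (c * s), \<epsilon> * \<delta> * s\<^sup>2])"
      by (simp add: quat_mult_def cross3_simps forall_3 axis_def power2_eq_square)
    then have "(c\<^sup>2, vector [\<epsilon> * (c * s), \<delta> * (c * s), \<epsilon> * \<delta> * s\<^sup>2]) \<in> \<Gamma>"
      using mult[OF gen'[of 1 \<epsilon>] gen'[of 2 \<delta>]] sgn by simp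
    then show ?thesis
      by (rule unit_quat_full_axis) (use irr in auto)
  qed
  show ?thesis
  proof (rule full_axes_spanning[OF _ _ u])
    show "full_axes \<noteq> {}"
      using axes[of 1 1] by auto
    fix w :: "real ^ 3"
    assume w: "\<And>z. z \<in> full_axes \<Longrightarrow> z \<bullet> w = 0"
    have *: "\<epsilon> * (c * s) * w $ 1 + \<delta> * (c * s) * w $ 2 + \<epsilon> * \<delta> * s\<^sup>2 * w $ 3 = 0"
      if sgn: "\<epsilon> \<in> {1, -1}" "\<delta> \<in> {1, -1}" for \<epsilon> \<delta>
    proof -
      obtain l where "l \<noteq> 0" "l *\<^sub>R vector [\<epsilon> * (c * s), \<delta> * (c * s), \<epsilon> * \<delta> * s\<^sup>2] \<in> full_axes"
        using axes[OF sgn] by blast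
      then have "vector [\<epsilon> * (c * s), \<delta> * (c * s), \<epsilon> * \<delta> * s\<^sup>2] \<bullet> w = 0"
        using w by fastforce
      then show ?thesis
        by (simp add: inner_vec_def sum_3)
    qed
    \<comment> \<open>Adding two of the three relations at a time isolates one coordinate of
      \<open>w\<close>.\<close>
    have "c * s * w $ 1 = 0" "c * s * w $ 2 = 0" "s\<^sup>2 * w $ 3 = 0"
      using *[of 1 1, simplified] *[of 1 "-1", simplified] *[of "-1" 1, simplified] by linarith+
    then show "w = 0"
      using \<open>c \<noteq> 0\<close> \<open>s \<noteq> 0\<close> by (simp add: vec_eq_iff forall_3)
  qed
qed

end

section \<open>Rotations in three coordinates\<close>

definition coords3 :: "'n \<Rightarrow> 'n \<Rightarrow> 'n \<Rightarrow> real ^ 'n \<Rightarrow> real ^ 3" where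
  "coords3 i j k x = vector [x $ i, x $ j, x $ k]"

definition put_coords3 :: "'n \<Rightarrow> 'n \<Rightarrow> 'n \<Rightarrow> real ^ 3 \<Rightarrow> real ^ 'n \<Rightarrow> real ^ 'n" where
  "put_coords3 i j k v x =
     (\<chi> l. if l = i then v $ 1 else if l = j then v $ 2 else if l = k then v $ 3 else x $ l)"

definition coord_rot :: "'n \<Rightarrow> 'n \<Rightarrow> 'n \<Rightarrow> quat \<Rightarrow> real ^ 'n \<Rightarrow> real ^ 'n" where
  "coord_rot i j k p x = put_coords3 i j k (quat_rot p (coords3 i j k x)) x"

lemma coords3_put: "distinct [i, j, k] \<Longrightarrow> coords3 i j k (put_coords3 i j k v x) = v"
  by (auto simp: coords3_def put_coords3_def vec_eq_iff forall_3)

lemma put_coords3_put: "put_coords3 i j k v (put_coords3 i j k w x) = put_coords3 i j k v x"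
  by (simp add: put_coords3_def vec_eq_iff)

lemma put_coords3_coords3: "put_coords3 i j k (coords3 i j k x) x = x"
  by (simp add: put_coords3_def coords3_def vec_eq_iff)

lemma coord_rot_mult:
  "distinct [i, j, k] \<Longrightarrow> coord_rot i j k (quat_mult p s) x = coord_rot i j k p (coord_rot i j k s x)"
  by (simp only: coord_rot_def quat_rot_mult coords3_put put_coords3_put)

lemma coord_rot_1: "coord_rot i j k (1, 0) x = x"
  by (simp add: coord_rot_def quat_rot_1 put_coords3_coords3)

lemma coord_rot_conj_left:
  "distinct [i, j, k] \<Longrightarrow> norm p = 1 \<Longrightarrow> coord_rot i j k (quat_conj p) (coord_rot i j k p x) = x"
  by (simp only: coord_rot_mult[symmetric] quat_mult_conj_left coord_rot_1)

lemma coord_rot_conj_right: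
  "distinct [i, j, k] \<Longrightarrow> norm p = 1 \<Longrightarrow> coord_rot i j k p (coord_rot i j k (quat_conj p) x) = x"
  by (simp only: coord_rot_mult[symmetric] quat_mult_conj_right coord_rot_1)

lemma tendsto_coord_rot:
  assumes "(f \<longlongrightarrow> p) F"
  shows "((\<lambda>n. coord_rot i j k (f n) x) \<longlongrightarrow> coord_rot i j k p x) F"
proof -
  have "((\<lambda>n. quat_rot (f n) w) \<longlongrightarrow> quat_rot p w) F" for w
    unfolding quat_rot_def
    by (intro tendsto_intros assms bounded_bilinear.tendsto[OF bilinear_cross[unfolded bilinear_conv_bounded_bilinear]])
  then show ?thesis
    unfolding coord_rot_def put_coords3_def
    by (intro tendsto_vec_lambda) (auto intro: tendsto_vec_nth)
qed

text \<open>Let elements f n of the stabilizer tend to \<open>p\<close>, and let z be the image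
  under \<open>p\<close> of a point x of \<open>\<Omega>\<close>. The inverses of the f n carry z to
  points tending to x, so one of them lies in the open set \<open>\<Omega>\<close>; applying that f
  n brings it back to z, so z is in \<open>\<Omega>\<close>.\<close>

lemma closed_quat_group_stabilizer:
  fixes \<Omega> :: "(real ^ 'n) set"
  assumes "open \<Omega>" and dist: "distinct [i, j, k]"
  shows "closed_quat_group {p. norm p = 1 \<and>
    (\<forall>x\<in>\<Omega>. coord_rot i j k p x \<in> \<Omega> \<and> coord_rot i j k (quat_conj p) x \<in> \<Omega>)}"
    (is "closed_quat_group ?\<Gamma>")
proof
  have limit: "coord_rot i j k p x \<in> \<Omega>"
    if f: "f \<longlonglongrightarrow> p" and p: "norm p = 1" and x: "x \<in> \<Omega>"
      and f1: "\<And>n. norm (f n) = 1"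
      and stab: "\<And>n y. y \<in> \<Omega> \<Longrightarrow> coord_rot i j k (f n) y \<in> \<Omega>" for f :: "nat \<Rightarrow> quat" and p x
  proof -
    let ?z = "coord_rot i j k p x"
    have "(\<lambda>n. quat_conj (f n)) \<longlonglongrightarrow> quat_conj p"
      unfolding quat_conj_def by (intro tendsto_intros f)
    then have "(\<lambda>n. coord_rot i j k (quat_conj (f n)) ?z) \<longlonglongrightarrow> coord_rot i j k (quat_conj p) ?z"
      by (rule tendsto_coord_rot)
    then have "(\<lambda>n. coord_rot i j k (quat_conj (f n)) ?z) \<longlonglongrightarrow> x"
      by (simp only: coord_rot_conj_left[OF dist p])
    then obtain n where "coord_rot i j k (quat_conj (f n)) ?z \<in> \<Omega>"
      using topological_tendstoD[OF _ \<open>open \<Omega>\<close> x] by (fastforce simp: eventually_sequentially)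
    from stab[OF this, of n] show ?thesis
      by (simp only: coord_rot_conj_right[OF dist f1])
  qed
  show "closed ?\<Gamma>"
    unfolding closed_sequential_limits
  proof (intro allI impI)
    fix f :: "nat \<Rightarrow> quat" and p
    assume *: "(\<forall>n. f n \<in> ?\<Gamma>) \<and> f \<longlonglongrightarrow> p"
    then have f1: "norm (f n) = 1" for n
      by simp
    have "(\<lambda>n. norm (f n)) \<longlonglongrightarrow> norm p"
      using * by (intro tendsto_norm) simp
    then have p: "norm p = 1"
      by (simp add: f1 LIMSEQ_const_iff)
    have conj_lim: "(\<lambda>n. quat_conj (f n)) \<longlonglongrightarrow> quat_conj p"
      unfolding quat_conj_def using * by (intro tendsto_intros) auto
    have "coord_rot i j k p x \<in> \<Omega>" if "x \<in> \<Omega>" for x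
      by (rule limit[of f, OF _ p that f1]) (use * in simp_all)
    moreover have "coord_rot i j k (quat_conj p) x \<in> \<Omega>" if "x \<in> \<Omega>" for x
      by (rule limit[OF conj_lim _ that]) (use * p in \<open>simp_all add: norm_quat_conj\<close>)
    ultimately show "p \<in> ?\<Gamma>"
      using p by simp
  qed
qed (simp_all add: norm_quat_mult norm_quat_conj quat_conj_mult quat_conj_conj coord_rot_mult[OF dist])

section \<open>Plane rotations as quaternion rotations about coordinate axes\<close>

lemma half_angle:
  "cos t = (cos (t / 2))\<^sup>2 - (sin (t / 2))\<^sup>2" "sin t = 2 * cos (t / 2) * sin (t / 2)"
  "(cos (t / 2))\<^sup>2 + (sin (t / 2))\<^sup>2 = 1" for t :: real
  using cos_double[of "t / 2"] sin_double[of "t / 2"] by simp_all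

text \<open>Kept as polynomial identities in independent \<open>c\<close> and \<open>s\<close>;
  trigonometry enters only when half angles are substituted.\<close>

lemma quat_rot_axis:
  "quat_rot (c, s *\<^sub>R axis 1 1) v = vector [(c\<^sup>2 + s\<^sup>2) * v $ 1,
     (c\<^sup>2 - s\<^sup>2) * v $ 2 - (2 * c * s) * v $ 3, (2 * c * s) * v $ 2 + (c\<^sup>2 - s\<^sup>2) * v $ 3]"
  "quat_rot (c, s *\<^sub>R axis 2 1) v = vector [(2 * c * s) * v $ 3 + (c\<^sup>2 - s\<^sup>2) * v $ 1,
     (c\<^sup>2 + s\<^sup>2) * v $ 2, (c\<^sup>2 - s\<^sup>2) * v $ 3 - (2 * c * s) * v $ 1]"
  "quat_rot (c, s *\<^sub>R axis 3 1) v = vector [(c\<^sup>2 - s\<^sup>2) * v $ 1 - (2 * c * s) * v $ 2,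
     (2 * c * s) * v $ 1 + (c\<^sup>2 - s\<^sup>2) * v $ 2, (c\<^sup>2 + s\<^sup>2) * v $ 3]"
  by (rule vec3_eqI; simp add: quat_rot_def inner_vec3 cross_components axis_def; algebra)+

text \<open>Right-handed orientation pairs the axes with the planes in cyclic order, hence
  \<open>k i\<close> and not \<open>i k\<close> for the second axis.\<close>

lemma coord_rot_eq_plane_rotation:
  assumes "distinct [i, j, k]"
  shows "coord_rot i j k (quat_cis (axis 1 1) (t / 2)) x = plane_rotation j k t *v x"
    and "coord_rot i j k (quat_cis (axis 2 1) (t / 2)) x = plane_rotation k i t *v x"
    and "coord_rot i j k (quat_cis (axis 3 1) (t / 2)) x = plane_rotation i j t *v x"
proof -
  have rot: "quat_rot (quat_cis (axis 1 1) (t / 2)) v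
        = vector [v $ 1, cos t * v $ 2 - sin t * v $ 3, sin t * v $ 2 + cos t * v $ 3]"
    "quat_rot (quat_cis (axis 2 1) (t / 2)) v
        = vector [sin t * v $ 3 + cos t * v $ 1, v $ 2, cos t * v $ 3 - sin t * v $ 1]"
    "quat_rot (quat_cis (axis 3 1) (t / 2)) v
        = vector [cos t * v $ 1 - sin t * v $ 2, sin t * v $ 1 + cos t * v $ 2, v $ 3]" for v
    unfolding half_angle(1,2)[of t] quat_rot_axis half_angle(3) by simp_all
  show "coord_rot i j k (quat_cis (axis 1 1) (t / 2)) x = plane_rotation j k t *v x"
    "coord_rot i j k (quat_cis (axis 2 1) (t / 2)) x = plane_rotation k i t *v x"
    "coord_rot i j k (quat_cis (axis 3 1) (t / 2)) x = plane_rotation i j t *v x"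
    using assms
    by (auto simp: coord_rot_def rot put_coords3_def coords3_def plane_rotation_mult vec_eq_iff)
qed

lemma ex_third_index:
  fixes i j :: "'n::finite"
  assumes "CARD('n) \<ge> 3"
  obtains k :: 'n where "k \<noteq> i" "k \<noteq> j"
proof -
  have "card {i, j} < CARD('n)"
    using assms card_insert_le_m1[of 2 "{j}" i] by auto
  then have "{i, j} \<noteq> UNIV"
    by force
  then show thesis
    using that by auto
qed

text \<open>With a third index \<open>k\<close>, the rotations in the planes \<open>j k\<close> and
  \<open>k i\<close> serve as the two generators, and the wanted plane \<open>i j\<close> belongs to
  the third axis. Both signs of the angle are assumed because membership in \<open>\<Gamma>\<close>
  also concerns inverses.\<close>

lemma plane_rotation_all_angles:
  fixes \<Omega> :: "(real ^ 'n::finite) set"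
  assumes N: "CARD('n) \<ge> 3" and "open \<Omega>" and q: "q > 0" "\<not> q dvd 4"
    and stab: "\<And>i j x. i \<noteq> j \<Longrightarrow> x \<in> \<Omega> \<Longrightarrow> plane_rotation i j (2 * pi / real q) *v x \<in> \<Omega>"
      "\<And>i j x. i \<noteq> j \<Longrightarrow> x \<in> \<Omega> \<Longrightarrow> plane_rotation i j (- (2 * pi / real q)) *v x \<in> \<Omega>"
    and ij: "i \<noteq> j" and x: "x \<in> \<Omega>"
  shows "plane_rotation i j t *v x \<in> \<Omega>"
proof -
  obtain k where k: "k \<noteq> i" "k \<noteq> j"
    using ex_third_index[OF N] by metis
  then have dist: "distinct [i, j, k]"
    using ij by auto
  define \<Gamma> where "\<Gamma> = {p. norm p = 1 \<and>
    (\<forall>x\<in>\<Omega>. coord_rot i j k p x \<in> \<Omega> \<and> coord_rot i j k (quat_conj p) x \<in> \<Omega>)}"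
  interpret closed_quat_group \<Gamma>
    unfolding \<Gamma>_def by (rule closed_quat_group_stabilizer[OF \<open>open \<Omega>\<close> dist])
  have gen: "quat_cis (axis 1 1) (2 * pi / real q / 2) \<in> \<Gamma>" "quat_cis (axis 2 1) (2 * pi / real q / 2) \<in> \<Gamma>"
    unfolding \<Gamma>_def mem_Collect_eq quat_conj_cis minus_divide_left[of _ 2] coord_rot_eq_plane_rotation[OF dist]
    using k by (intro conjI ballI norm_quat_cis norm_axis_1 stab; simp)+
  have "quat_cis (axis 3 1) (t / 2) \<in> \<Gamma>"
    by (rule two_generators_full[OF q]) (use gen in \<open>simp_all add: norm_axis_1\<close>)
  then show ?thesis
    using x unfolding \<Gamma>_def by (auto simp: coord_rot_eq_plane_rotation[OF dist])
qed

section \<open>Sets invariant under plane rotations\<close>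

lemma plane_rotation_0: "i \<noteq> j \<Longrightarrow> plane_rotation i j 0 *v x = x"
  by (simp add: plane_rotation_mult vec_eq_iff)

lemma plane_rotation_uminus: "i \<noteq> j \<Longrightarrow> plane_rotation i j (- t) *v (plane_rotation i j t *v x) = x"
  by (simp add: matrix_vector_mul_assoc plane_rotation_add plane_rotation_0)

lemma plane_rotation_swap: "i \<noteq> j \<Longrightarrow> plane_rotation j i t *v x = plane_rotation i j (- t) *v x"
  by (auto simp: plane_rotation_mult vec_eq_iff)

lemma norm_SO_mult: "T \<in> SO \<Longrightarrow> norm (T *v x) = norm x"
  using orthogonal_transformation_matrix[of "(*v) T"] orthogonal_transformation_norm
  by (auto simp: SO_def rotation_matrix_def matrix_of_matrix_vector_mul)

locale rotation_invariant =
  fixes \<Omega> :: "(real ^ 'n::finite) set"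
  assumes invariant: "i \<noteq> j \<Longrightarrow> x \<in> \<Omega> \<Longrightarrow> plane_rotation i j t *v x \<in> \<Omega>"
begin

lemma plane_rotation_mem_iff:
  "i \<noteq> j \<Longrightarrow> plane_rotation i j t *v x \<in> \<Omega> \<longleftrightarrow> x \<in> \<Omega>"
  using invariant[of i j x t] invariant[of i j "plane_rotation i j t *v x" "- t"]
  by (auto simp: plane_rotation_uminus)

text \<open>Each coordinate in \<open>F\<close> is rotated into coordinate \<open>i\<close>, one
  plane at a time; rotating in the plane \<open>i m\<close> leaves the zeros already made
  untouched.\<close>

lemma rotate_coords_to_0:
  assumes "finite F" "i \<notin> F"
  shows "\<exists>y. norm y = norm x \<and> (\<forall>l\<in>F. y $ l = 0) \<and> (y \<in> \<Omega> \<longleftrightarrow> x \<in> \<Omega>)"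
  using assms
proof (induction F rule: finite_induct)
  case empty
  then show ?case by auto
next
  case (insert m F)
  then obtain y where y: "norm y = norm x" "\<And>l. l \<in> F \<Longrightarrow> y $ l = 0" "y \<in> \<Omega> \<longleftrightarrow> x \<in> \<Omega>"
    by auto
  have im: "i \<noteq> m"
    using insert.prems by auto
  obtain r s where "y $ i = r * cos s" "y $ m = r * sin s"
    using polar_Ex by blast
  then have "(plane_rotation i m (- s) *v y) $ m = 0"
    using im by (simp add: plane_rotation_mult)
  moreover have "(plane_rotation i m (- s) *v y) $ l = 0" if "l \<in> F" for l
    using that insert im y(2) by (auto simp: plane_rotation_mult)
  ultimately show ?case
    using y(1,3) im
    by (intro exI[of _ "plane_rotation i m (- s) *v y"])
      (auto simp: norm_SO_mult plane_rotation_in_SO plane_rotation_mem_iff)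
qed

lemma mem_iff_axis_mem:
  assumes "i \<noteq> j"
  shows "x \<in> \<Omega> \<longleftrightarrow> norm x *\<^sub>R axis i 1 \<in> \<Omega>"
proof -
  obtain y where y: "norm y = norm x" "\<And>l. l \<noteq> i \<Longrightarrow> y $ l = 0" "y \<in> \<Omega> \<longleftrightarrow> x \<in> \<Omega>"
    using rotate_coords_to_0[of "UNIV - {i}" i x] by auto
  have ya: "y = y $ i *\<^sub>R axis i 1"
    using y(2) by (auto simp: vec_eq_iff axis_def)
  then have "norm y = norm (y $ i *\<^sub>R axis i (1 :: real))"
    by (rule arg_cong)
  then have "norm x = y $ i \<or> norm x = - (y $ i)"
    using y(1) by (simp add: norm_axis_1) linarith
  then consider "norm x *\<^sub>R axis i 1 = y" | "norm x *\<^sub>R axis i 1 = - y"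
    using ya[symmetric] by (metis scaleR_minus_left)
  then show ?thesis
  proof cases
    case 1
    then show ?thesis using y(3) by simp
  next
    case 2
    \<comment> \<open>Only coordinate \<open>i\<close> of \<open>y\<close> can be nonzero, so a half
      turn in any plane containing that axis negates \<open>y\<close>.\<close>
    have "plane_rotation i j pi *v y = - y"
      using assms y(2) by (auto simp: plane_rotation_mult vec_eq_iff)
    then show ?thesis
      using 2 y(3) plane_rotation_mem_iff[OF assms, of pi y] by simp
  qed
qed

lemma mem_norm_cong:
  assumes "i \<noteq> (j :: 'n)" "norm x = norm y" "x \<in> \<Omega>"
  shows "y \<in> \<Omega>"
  using assms(2,3) mem_iff_axis_mem[OF assms(1), of x] mem_iff_axis_mem[OF assms(1), of y] by simp

end

section \<open>From the generating rotations to the whole rotation group\<close>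

theorem proposition5p1:
  fixes \<Omega> :: "(real ^ 'n::{finite, linorder}) set"
    and H :: "(real ^ 'n::{finite, linorder} ^ 'n::{finite, linorder}) set"
    and q :: nat
  assumes "CARD('n) \<ge> 3"
    and "open \<Omega>" and "connected \<Omega>"
    and "H = {T \<in> SO. (\<lambda>x. T *v x) ` \<Omega> = \<Omega>}"
    and "q \<ge> 1" and "q \<notin> {1, 2, 4}"
    and "rotation_subgroup q \<subseteq> H"
  shows "H = SO"
proof -
  define \<alpha> where "\<alpha> = 2 * pi / real q"
  have image: "(\<lambda>x. plane_rotation i j \<alpha> *v x) ` \<Omega> = \<Omega>" if "i < j" for i j
  proof -
    have "plane_rotation i j \<alpha> \<in> rotation_subgroup q"
      unfolding rotation_subgroup_def \<alpha>_def using that by (blast intro: generate.incl)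
    then show ?thesis
      using assms(4,7) by blast
  qed
  have stab: "plane_rotation i j \<alpha> *v x \<in> \<Omega> \<and> plane_rotation i j (- \<alpha>) *v x \<in> \<Omega>"
    if lt: "i < j" and x: "x \<in> \<Omega>" for i j x
  proof
    show "plane_rotation i j \<alpha> *v x \<in> \<Omega>"
      using image[OF lt] x by blast
    obtain y where "y \<in> \<Omega>" "x = plane_rotation i j \<alpha> *v y"
      using image[OF lt] x by blast
    then show "plane_rotation i j (- \<alpha>) *v x \<in> \<Omega>"
      using lt by (simp add: plane_rotation_uminus)
  qed
  \<comment> \<open>Swapping the indices inverts the rotation, so having both signs for
    \<open>i < j\<close> covers all pairs of distinct indices.\<close>
  have stab': "plane_rotation i j \<alpha> *v x \<in> \<Omega>" "plane_rotation i j (- \<alpha>) *v x \<in> \<Omega>"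
    if "i \<noteq> j" "x \<in> \<Omega>" for i j x
    using that stab[of i j x] stab[of j i x] plane_rotation_swap[of j i] by (cases i j rule: linorder_cases; simp)+
  \<comment> \<open>The excluded values 1, 2, 4 are exactly the positive divisors of 4.\<close>
  have "q \<le> 4" if "q dvd 4"
    using that by (intro dvd_imp_le) auto
  moreover have "\<not> 3 dvd (4 :: nat)"
    by simp
  ultimately have "\<not> q dvd 4"
    using assms(5,6) by (cases "q = 3") auto
  interpret rotation_invariant \<Omega>
  proof
    show "plane_rotation i j t *v x \<in> \<Omega>" if "i \<noteq> j" "x \<in> \<Omega>" for i j t x
      by (rule plane_rotation_all_angles[OF assms(1,2) _ \<open>\<not> q dvd 4\<close> _ _ that])
        (use assms(5) stab' in \<open>auto simp: \<alpha>_def\<close>)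
  qed
  obtain i j :: 'n where ij: "i \<noteq> j"
    using ex_third_index[OF assms(1)] by metis
  have "(\<lambda>x. T *v x) ` \<Omega> = \<Omega>" if T: "T \<in> SO" for T
  proof
    show "(\<lambda>x. T *v x) ` \<Omega> \<subseteq> \<Omega>"
      using mem_norm_cong[OF ij] norm_SO_mult[OF T] by (metis image_subsetI)
    show "\<Omega> \<subseteq> (\<lambda>x. T *v x) ` \<Omega>"
    proof
      fix y
      assume "y \<in> \<Omega>"
      \<comment> \<open>The transpose is the inverse of \<open>T\<close>, so \<open>x\<close> is the
        preimage of \<open>y\<close>; it has the same norm and hence lies in
        \<open>\<Omega>\<close>.\<close>
      define x where "x = transpose T *v y"
      have "T *v x = y"
        unfolding x_def matrix_vector_mul_assoc
        using T by (simp add: SO_def rotation_matrix_def orthogonal_matrix_def)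
      then show "y \<in> (\<lambda>x. T *v x) ` \<Omega>"
        using mem_norm_cong[OF ij] norm_SO_mult[OF T, of x] \<open>y \<in> \<Omega>\<close> by (metis image_eqI)
    qed
  qed
  then show ?thesis
    using assms(4) by blast
qed

end
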